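(* Let $n$ be a positive integer, and let $a$ and $r$ be non-negative integers with $a\leqslant n$. Then, for every integer $j$ with $0\leqslant j\leqslant 2r+1$, $$ \sum_{k=a}^{n}(1+q^k)B_{n,k}(q)^{2r+1} q^{jk^2-(r+1)k} \equiv 0\pmod{(1+q^n){2n-1\brack n-a}}. $$
   Context: $q$ is an indeterminate. The $q$-integers are $[n]=\frac{1-q^n}{1-q}$, and $(a;q)_0=1$, $(a;q)_n=(1-a)(1-aq)\cdots(1-aq^{n-1})$. The $q$-binomial coefficient is ${n\brack k}=\frac{(q;q)_n}{(q;q)_k(q;q)_{n-k}}$ if $0\leqslant k\leqslant n$ and $0$ otherwise. For $0\leqslant k\leqslant n$, $B_{n,k}(q)=\frac{[k]}{[n]}{2n\brack n-k}$ (a polynomial in $q$; in particular $B_{n,0}(q)=0$). For a Laurent polynomial $P(q)$ and a polynomial $D(q)$, $P(q)\equiv 0\pmod{D(q)}$ means that $P(q)/D(q)$ is a Laurent polynomial in $q$. *)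

theory Defs
  imports "HOL-Computational_Algebra.Computational_Algebra"
begin

text \<open>
  Everything lives in the field of fractions of \<open>\<int>[q]\<close>, so that \<open>q\<close> is an indeterminate, quotients
  such as \<open>(1 - q ^ n) / (1 - q)\<close> make sense literally, and \<open>q\<close> has integer powers (written \<open>powi\<close>).
\<close>

definition qvar :: "int poly fract" where
  "qvar = to_fract [:0, 1:]"

definition qint :: "nat \<Rightarrow> int poly fract" where
  "qint n = (1 - qvar ^ n) / (1 - qvar)"

definition qpoch :: "int poly fract \<Rightarrow> nat \<Rightarrow> int poly fract" where
  "qpoch a n = (\<Prod>i<n. 1 - a * qvar ^ i)"

definition qbinom :: "nat \<Rightarrow> nat \<Rightarrow> int poly fract" where
  "qbinom n k = (if k \<le> n then qpoch qvar n / (qpoch qvar k * qpoch qvar (n - k)) else 0)"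

text \<open>Only meaningful for \<open>k \<le> n\<close> and \<open>n > 0\<close> (the subtraction is truncated on \<open>nat\<close>).\<close>

definition Bpoly :: "nat \<Rightarrow> nat \<Rightarrow> int poly fract" where
  "Bpoly n k = qint k / qint n * qbinom (2 * n) (n - k)"

text \<open>Laurent polynomials with integer coefficients, as elements of the fraction field.\<close>

definition is_laurent_poly :: "int poly fract \<Rightarrow> bool" where
  "is_laurent_poly x \<longleftrightarrow> (\<exists>p m. x = to_fract p / qvar ^ m)"

text \<open>
  \<open>P \<equiv> 0 (mod D)\<close>. The conjunct \<open>D \<noteq> 0\<close> excludes the degenerate case in which \<open>P / D\<close> would be \<open>0\<close>
  by the convention for division by zero.
\<close>

definition laurent_cong_0 :: "int poly fract \<Rightarrow> int poly fract \<Rightarrow> bool" where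
  "laurent_cong_0 P D \<longleftrightarrow> D \<noteq> 0 \<and> is_laurent_poly (P / D)"

end

theory Submission
  imports Defs
begin

text \<open>
  Put \<open>\<psi>\<^sub>i(k) = [n - k, i] [n + k, i]\<close> (\<open>q\<close>-binomials). Multiplied by \<open>(1 + q\<^sup>k) B\<^sub>n\<^sub>,\<^sub>k q\<^sup>-\<^sup>k\<close>, optionally times
  \<open>q^(k\<^sup>2)\<close>, the function \<open>\<psi>\<^sub>i\<close> becomes telescoping, and its sum over \<open>k \<ge> a\<close> is a unit times
  \<open>[n - a, i] [n + a - 1, i]\<close> times the modulus. So it suffices that the remaining factor
  \<open>(q\<^sup>-\<^sup>k B\<^sub>n\<^sub>,\<^sub>k\<^sup>2)\<^sup>r q^(j k\<^sup>2)\<close>, \<open>j \<le> 2 r\<close>, is a combination of the \<open>\<psi>\<^sub>i\<close> with Laurent polynomial coefficients.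
  The two forms of the \<open>q\<close>-Vandermonde identity show that multiplication by \<open>P\<^sub>k = [2 n, n - k]\<close> and
  by \<open>q^(k\<^sup>2) P\<^sub>k\<close> preserves the set of such combinations. Since
  \<open>q^(n - k) [k]\<^sup>2 = [n]\<^sup>2 - [n - k] [n + k]\<close>, the remaining task is to absorb \<open>[n - k] [n + k] / [n]\<^sup>2\<close>: each
  of the two factors \<open>P\<^sub>k\<close> contributes one factor \<open>[2 n]\<close>, because
  \<open>[2 n - i] [2 n, i] = [2 n] [2 n - 1, i]\<close> and \<open>[i] [2 n, i] = [2 n] [2 n - 1, i - 1]\<close>.
\<close>

subsection \<open>Laurent polynomials\<close>

lemma qvar_nonzero [simp]: "qvar \<noteq> 0"
  by (simp add: qvar_def)

lemma qvar_power: "qvar ^ n = to_fract (monom 1 n)"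
proof (induction n)
  case (Suc n)
  then show ?case
    by (simp add: qvar_def monom_altdef flip: to_fract_mult)
qed simp

lemma qvar_power_neq_1 [simp]: "0 < n \<Longrightarrow> qvar ^ n \<noteq> 1"
proof
  assume "0 < n" "qvar ^ n = 1"
  then have "to_fract (monom (1::int) n) = to_fract 1"
    by (simp add: qvar_power)
  then have "monom (1::int) n = 1"
    by (simp only: to_fract_eq_iff)
  then have "degree (monom (1::int) n) = 0"
    by simp
  with \<open>0 < n\<close> show False
    by (simp add: degree_monom_eq)
qed

lemma one_minus_qvar_power_eq_0_iff [simp]: "1 - qvar ^ n = 0 \<longleftrightarrow> n = 0"
  using qvar_power_neq_1 [of n] by (cases "n = 0") auto

lemma qvar_neq_1 [simp]: "qvar \<noteq> 1"
  using qvar_power_neq_1 [of 1] by simp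

lemma laurent_to_fract: "is_laurent_poly (to_fract p)"
  unfolding is_laurent_poly_def by (intro exI [of _ p] exI [of _ 0]) simp

lemma laurent_0 [simp]: "is_laurent_poly 0"
  using laurent_to_fract [of 0] by simp

lemma laurent_1 [simp]: "is_laurent_poly 1"
  using laurent_to_fract [of 1] by simp

lemma laurent_qvar_power [simp]: "is_laurent_poly (qvar ^ n)"
  using laurent_to_fract by (simp add: qvar_power)

lemma laurent_inverse_qvar_power [simp]: "is_laurent_poly (inverse (qvar ^ n))"
  unfolding is_laurent_poly_def by (intro exI [of _ 1] exI [of _ n]) (simp add: field_simps)

lemma laurent_add [intro]:
  assumes "is_laurent_poly x" "is_laurent_poly y"
  shows "is_laurent_poly (x + y)"
proof -
  obtain p m where x: "x = to_fract p / qvar ^ m"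
    using assms(1) by (auto simp: is_laurent_poly_def)
  obtain p' m' where y: "y = to_fract p' / qvar ^ m'"
    using assms(2) by (auto simp: is_laurent_poly_def)
  have "x + y = to_fract (p * monom 1 m' + p' * monom 1 m) / qvar ^ (m + m')"
    unfolding x y by (simp add: field_simps power_add flip: qvar_power)
  then show ?thesis
    unfolding is_laurent_poly_def by blast
qed

lemma laurent_mult [intro]:
  assumes "is_laurent_poly x" "is_laurent_poly y"
  shows "is_laurent_poly (x * y)"
proof -
  obtain p m where x: "x = to_fract p / qvar ^ m"
    using assms(1) by (auto simp: is_laurent_poly_def)
  obtain p' m' where y: "y = to_fract p' / qvar ^ m'"
    using assms(2) by (auto simp: is_laurent_poly_def)
  have "x * y = to_fract (p * p') / qvar ^ (m + m')"
    unfolding x y by (simp add: field_simps power_add)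
  then show ?thesis
    unfolding is_laurent_poly_def by blast
qed

lemma laurent_uminus [intro]: "is_laurent_poly x \<Longrightarrow> is_laurent_poly (- x)"
  using laurent_mult [of "to_fract (- 1)" x] laurent_to_fract [of "- 1"] by simp

lemma laurent_power [intro]: "is_laurent_poly x \<Longrightarrow> is_laurent_poly (x ^ n)"
  by (induction n) auto

lemma laurent_sum [intro]:
  "(\<And>i. i \<in> I \<Longrightarrow> is_laurent_poly (f i)) \<Longrightarrow> is_laurent_poly (sum f I)"
  by (induction I rule: infinite_finite_induct) auto

subsection \<open>\<open>q\<close>-integers and \<open>q\<close>-binomial coefficients\<close>

lemma qint_0 [simp]: "qint 0 = 0"
  by (simp add: qint_def)

lemma qint_eq_0_iff [simp]: "qint n = 0 \<longleftrightarrow> n = 0"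
  using one_minus_qvar_power_eq_0_iff [of n] by (auto simp: qint_def)

lemma qint_mult: "(1 - qvar) * qint n = 1 - qvar ^ n"
  by (simp add: qint_def)

lemma qint_add: "qint (m + n) = qint m + qvar ^ m * qint n"
  by (simp add: qint_def field_simps power_add)

lemma qint_double: "qint (2 * n) = (1 + qvar ^ n) * qint n"
  using qint_add [of n n] by (simp add: algebra_simps flip: mult_2)

lemma qpoch_0 [simp]: "qpoch qvar 0 = 1"
  by (simp add: qpoch_def)

lemma qpoch_Suc: "qpoch qvar (Suc n) = qpoch qvar n * ((1 - qvar) * qint (Suc n))"
  by (simp add: qpoch_def qint_mult)

lemma qpoch_neq_0 [simp]: "qpoch qvar n \<noteq> 0"
  by (induction n) (simp_all add: qpoch_Suc)

lemma qbinom_gt [simp]: "n < k \<Longrightarrow> qbinom n k = 0"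
  by (simp add: qbinom_def)

lemma qbinom_0 [simp]: "qbinom n 0 = 1"
  by (simp add: qbinom_def)

lemma qbinom_self [simp]: "qbinom n n = 1"
  by (simp add: qbinom_def)

lemma qbinom_neq_0 [simp]: "k \<le> n \<Longrightarrow> qbinom n k \<noteq> 0"
  by (simp add: qbinom_def)

lemma qbinom_absorb: "qint (Suc k) * qbinom (Suc n) (Suc k) = qint (Suc n) * qbinom n k"
  by (simp add: qbinom_def qpoch_Suc)

lemma qbinom_absorb_comp:
  "qint (Suc n - k) * qbinom (Suc n) k = qint (Suc n) * qbinom n k"
proof (cases "k \<le> n")
  case True
  then show ?thesis
    by (simp add: qbinom_def qpoch_Suc Suc_diff_le)
next
  case False
  then show ?thesis
    by (cases "k = Suc n") auto
qed

text \<open>For \<open>n > 0\<close> both sides equal \<open>[n] [n - 1, k]\<close> by the two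
  absorption rules. For \<open>k >= n\<close> truncation makes \<open>n - k\<close> zero, so both
  sides vanish and no bound on \<open>k\<close> is required.\<close>

lemma qbinom_step: "qint (Suc k) * qbinom n (Suc k) = qint (n - k) * qbinom n k"
proof (cases n)
  case (Suc n')
  then show ?thesis
    using qbinom_absorb [of k n'] qbinom_absorb_comp [of n' k] by simp
qed simp

text \<open>One half of the \<open>q\<close>-Pascal rule: over a common denominator it is the
  splitting \<open>[n + 1] = [k + 1] + q^(k + 1) [n - k]\<close>.\<close>

lemma qbinom_Suc_Suc: "qbinom (Suc n) (Suc k) = qbinom n k + qvar ^ Suc k * qbinom n (Suc k)"
proof (cases "k < n")
  case True
  then obtain d where n: "n = Suc k + d"
    using less_iff_Suc_add by auto
  have "qint (Suc n) = qint (Suc k) + qvar ^ Suc k * qint (Suc d)"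
    using qint_add [of "Suc k" "Suc d"] by (simp add: n)
  then have "qbinom (Suc n) (Suc k) = qpoch qvar n * ((1 - qvar) * (qint (Suc k) + qvar ^ Suc k * qint (Suc d)))
      / (qpoch qvar (Suc k) * qpoch qvar (Suc d))"
    by (simp add: qbinom_def n qpoch_Suc add.commute del: power_Suc)
  moreover have "qbinom n k = qpoch qvar n * ((1 - qvar) * qint (Suc k))
      / (qpoch qvar (Suc k) * qpoch qvar (Suc d))"
    by (simp add: qbinom_def n qpoch_Suc Suc_diff_le)
  moreover have "qbinom n (Suc k) = qpoch qvar n * ((1 - qvar) * qint (Suc d))
      / (qpoch qvar (Suc k) * qpoch qvar (Suc d))"
    by (simp add: qbinom_def n qpoch_Suc)
  moreover have "n - k = Suc d"
    by (simp add: n)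
  ultimately show ?thesis
    by (simp add: distrib_left add_divide_distrib mult_ac del: power_Suc)
next
  case False
  then show ?thesis
    by (cases "k = n") auto
qed

text \<open>The other half, from the opposite splitting
  \<open>[n + 1] = [n - k] + q^(n - k) [k + 1]\<close>.\<close>

lemma qbinom_Suc_Suc': "qbinom (Suc n) (Suc k) = qvar ^ (n - k) * qbinom n k + qbinom n (Suc k)"
proof (cases "k < n")
  case True
  then obtain d where n: "n = Suc k + d"
    using less_iff_Suc_add by auto
  have "qint (Suc n) = qint (Suc d) + qvar ^ Suc d * qint (Suc k)"
    using qint_add [of "Suc d" "Suc k"] by (simp add: n add.commute)
  then have "qbinom (Suc n) (Suc k) = qpoch qvar n * ((1 - qvar) * (qvar ^ Suc d * qint (Suc k) + qint (Suc d)))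
      / (qpoch qvar (Suc k) * qpoch qvar (Suc d))"
    by (simp add: qbinom_def n qpoch_Suc add.commute del: power_Suc)
  moreover have "qbinom n k = qpoch qvar n * ((1 - qvar) * qint (Suc k))
      / (qpoch qvar (Suc k) * qpoch qvar (Suc d))"
    by (simp add: qbinom_def n qpoch_Suc Suc_diff_le)
  moreover have "qbinom n (Suc k) = qpoch qvar n * ((1 - qvar) * qint (Suc d))
      / (qpoch qvar (Suc k) * qpoch qvar (Suc d))"
    by (simp add: qbinom_def n qpoch_Suc)
  moreover have "n - k = Suc d"
    by (simp add: n)
  ultimately show ?thesis
    by (simp add: distrib_left add_divide_distrib mult_ac del: power_Suc)
next
  case False
  then show ?thesis
    by (cases "k = n") auto
qed

text \<open>The definition is a quotient; integrality comes from the \<open>q\<close>-Pascal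
  recurrence.\<close>

lemma laurent_qbinom [simp]: "is_laurent_poly (qbinom n k)"
proof (induction n arbitrary: k)
  case 0
  then show ?case
    by (cases k) auto
next
  case (Suc n)
  then show ?case
    by (cases k) (auto simp: qbinom_Suc_Suc simp del: power_Suc intro!: laurent_add laurent_mult)
qed

lemma qbinom_trinomial:
  assumes "i \<le> l" "l \<le> m"
  shows "qbinom m l * qbinom l i = qbinom m i * qbinom (m - i) (l - i)"
  using assms by (simp add: qbinom_def)

section \<open>The two forms of the \<open>q\<close>-Vandermonde identity\<close>

text \<open>Pascal's rule lowers \<open>m\<close>; applied backwards to the other binomial it raises
  \<open>b\<close> and \<open>i\<close>. Both \<open>m + b\<close> and \<open>m + i\<close> are
  preserved, so the induction has to keep \<open>b\<close> and \<open>i\<close> arbitrary.\<close>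

lemma qbinom_vandermonde:
  "(\<Sum>s\<le>m. qvar ^ (s * (s + i)) * qbinom m s * qbinom b (s + i)) = qbinom (m + b) (m + i)"
proof (induction m arbitrary: b i)
  case 0
  then show ?case by simp
next
  case (Suc m)
  have "(\<Sum>s\<le>Suc m. qvar ^ (s * (s + i)) * qbinom (Suc m) s * qbinom b (s + i)) =
        qbinom b i + (\<Sum>s\<le>m. qvar ^ (Suc s * (Suc s + i)) * qbinom m s * qbinom b (Suc s + i))
        + (\<Sum>s\<le>m. qvar ^ (Suc s * (Suc s + i)) * qvar ^ Suc s * qbinom m (Suc s) * qbinom b (Suc s + i))"
    by (simp add: sum.atMost_Suc_shift qbinom_Suc_Suc algebra_simps sum.distrib
             del: sum.atMost_Suc power_Suc)
  also have "(\<Sum>s\<le>m. qvar ^ (Suc s * (Suc s + i)) * qvar ^ Suc s * qbinom m (Suc s) * qbinom b (Suc s + i))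
     = (\<Sum>s\<le>Suc m. qvar ^ (s * (s + i)) * qvar ^ s * qbinom m s * qbinom b (s + i)) - qbinom b i"
    by (simp add: sum.atMost_Suc_shift del: sum.atMost_Suc power_Suc)
  \<comment> \<open>The top term vanishes because \<open>qbinom m (Suc m) = 0\<close>.\<close>
  also have "(\<Sum>s\<le>Suc m. qvar ^ (s * (s + i)) * qvar ^ s * qbinom m s * qbinom b (s + i)) =
        (\<Sum>s\<le>m. qvar ^ (s * (s + i)) * qvar ^ s * qbinom m s * qbinom b (s + i))"
    by simp
  \<comment> \<open>The stray \<open>qbinom b i\<close> cancels, and
    \<open>(s + 1) (s + 1 + i) = s (s + i + 1) + (s + i + 1)\<close> gives the power of
    \<open>q\<close> that Pascal's rule for \<open>qbinom (Suc b) (s + Suc i)\<close> asks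
    for.\<close>
  also have "qbinom b i + (\<Sum>s\<le>m. qvar ^ (Suc s * (Suc s + i)) * qbinom m s * qbinom b (Suc s + i))
        + ((\<Sum>s\<le>m. qvar ^ (s * (s + i)) * qvar ^ s * qbinom m s * qbinom b (s + i)) - qbinom b i)
      = (\<Sum>s\<le>m. qvar ^ (s * (s + Suc i)) * qbinom m s * qbinom (Suc b) (s + Suc i))"
    by (simp add: qbinom_Suc_Suc sum.distrib [symmetric] algebra_simps power_add)
  also have "\<dots> = qbinom (Suc m + b) (Suc m + i)"
    using Suc.IH [of "Suc i" "Suc b"] by simp
  finally show ?case .
qed

text \<open>Same induction with the other Pascal rule. The subtraction \<open>b - i - s\<close> is
  truncated only where \<open>qbinom b (s + i)\<close> is zero.\<close>

lemma qbinom_vandermonde':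
  "(\<Sum>s\<le>m. qvar ^ ((m - s) * (b - i - s)) * qbinom m s * qbinom b (s + i)) = qbinom (m + b) (m + i)"
proof (induction m arbitrary: b i)
  case 0
  then show ?case by simp
next
  case (Suc m)
  have "(\<Sum>s\<le>Suc m. qvar ^ ((Suc m - s) * (b - i - s)) * qbinom (Suc m) s * qbinom b (s + i)) =
        qvar ^ (Suc m * (b - i)) * qbinom b i
        + (\<Sum>s\<le>m. qvar ^ ((m - s) * (b - i - Suc s)) * qvar ^ (m - s) * qbinom m s * qbinom b (Suc s + i))
        + (\<Sum>s\<le>m. qvar ^ ((Suc m - Suc s) * (b - i - Suc s)) * qbinom m (Suc s) * qbinom b (Suc s + i))"
    \<comment> \<open>Distributivity is restricted to the fraction field so that the exponents in
      \<open>nat\<close> stay factored.\<close>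
    by (simp add: sum.atMost_Suc_shift qbinom_Suc_Suc' sum.distrib mult.assoc add.assoc
        distrib_left [where ?'a = "int poly fract"] distrib_right [where ?'a = "int poly fract"]
        del: sum.atMost_Suc power_Suc)
  also have "(\<Sum>s\<le>m. qvar ^ ((Suc m - Suc s) * (b - i - Suc s)) * qbinom m (Suc s) * qbinom b (Suc s + i))
     = (\<Sum>s\<le>Suc m. qvar ^ ((Suc m - s) * (b - i - s)) * qbinom m s * qbinom b (s + i))
       - qvar ^ (Suc m * (b - i)) * qbinom b i"
    by (simp add: sum.atMost_Suc_shift del: sum.atMost_Suc power_Suc)
  also have "(\<Sum>s\<le>Suc m. qvar ^ ((Suc m - s) * (b - i - s)) * qbinom m s * qbinom b (s + i)) =
        (\<Sum>s\<le>m. qvar ^ ((Suc m - s) * (b - i - s)) * qbinom m s * qbinom b (s + i))"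
    by simp
  also have "qvar ^ (Suc m * (b - i)) * qbinom b i
        + (\<Sum>s\<le>m. qvar ^ ((m - s) * (b - i - Suc s)) * qvar ^ (m - s) * qbinom m s * qbinom b (Suc s + i))
        + ((\<Sum>s\<le>m. qvar ^ ((Suc m - s) * (b - i - s)) * qbinom m s * qbinom b (s + i))
          - qvar ^ (Suc m * (b - i)) * qbinom b i)
      = (\<Sum>s\<le>m. qvar ^ ((m - s) * (b - i - Suc s)) * qvar ^ (m - s) * qbinom m s * qbinom b (Suc s + i)
          + qvar ^ ((Suc m - s) * (b - i - s)) * qbinom m s * qbinom b (s + i))"
    by (simp add: sum.distrib)
  also have "\<dots> = (\<Sum>s\<le>m. qvar ^ ((m - s) * (Suc b - Suc i - s)) * qbinom m s * qbinom (Suc b) (s + Suc i))"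
  proof (intro sum.cong refl)
    fix s assume "s \<in> {..m}"
    then have 1: "(Suc m - s) * (b - i - s) = (m - s) * (b - i - s) + (b - i - s)"
      by (simp add: Suc_diff_le)
    \<comment> \<open>This can fail at \<open>s + i = b\<close> through truncation, but there the
      accompanying \<open>qbinom b (Suc s + i)\<close> is zero.\<close>
    have 2: "(m - s) * (b - i - Suc s) + (m - s) = (m - s) * (b - i - s)" if "s + i < b"
    proof -
      have "b - i - s = Suc (b - i - Suc s)"
        using that by simp
      then show ?thesis
        by simp
    qed
    have 3: "qvar ^ ((m - s) * (b - i - Suc s)) * qvar ^ (m - s) * qbinom m s * qbinom b (Suc s + i)
      = qvar ^ ((m - s) * (b - i - s)) * qbinom m s * qbinom b (Suc s + i)"
    proof (cases "s + i < b")
      case True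
      then show ?thesis
        by (simp only: 2 flip: power_add)
    qed simp
    have 4: "qbinom (Suc b) (s + Suc i) = qvar ^ (b - i - s) * qbinom b (s + i) + qbinom b (Suc s + i)"
      using qbinom_Suc_Suc' [of b "s + i"] by (simp add: add.commute)
    show "qvar ^ ((m - s) * (b - i - Suc s)) * qvar ^ (m - s) * qbinom m s * qbinom b (Suc s + i)
          + qvar ^ ((Suc m - s) * (b - i - s)) * qbinom m s * qbinom b (s + i)
        = qvar ^ ((m - s) * (Suc b - Suc i - s)) * qbinom m s * qbinom (Suc b) (s + Suc i)"
      unfolding 1 3 4 by (simp add: algebra_simps power_add)
  qed
  also have "\<dots> = qbinom (Suc m + b) (Suc m + i)"
    using Suc.IH [of "Suc b" "Suc i"] by simp
  finally show ?case .
qed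

subsection \<open>The Laurent span of the products \<open>psi\<close>\<close>

definition psi :: "nat \<Rightarrow> nat \<Rightarrow> nat \<Rightarrow> int poly fract" where
  "psi n i k = qbinom (n - k) i * qbinom (n + k) i"

text \<open>The coefficients are independent of \<open>k\<close>, which later allows the sums over
  \<open>k\<close> and \<open>i\<close> to be exchanged. Values at \<open>k > n\<close>, where
  \<open>n - k\<close> is truncated, are ignored.\<close>

definition psi_span :: "nat \<Rightarrow> (nat \<Rightarrow> int poly fract) set" where
  "psi_span n = {g. \<exists>c. (\<forall>i. is_laurent_poly (c i)) \<and> (\<forall>k\<le>n. g k = (\<Sum>i\<le>n. c i * psi n i k))}"

lemma psi_eq_0 [simp]: "n - k < i \<Longrightarrow> psi n i k = 0"
  by (simp add: psi_def)

lemma psi_spanI: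
  assumes "\<And>i. i \<le> n \<Longrightarrow> is_laurent_poly (c i)"
    and "\<And>k. k \<le> n \<Longrightarrow> g k = (\<Sum>i\<le>n. c i * psi n i k)"
  shows "g \<in> psi_span n"
  unfolding psi_span_def
  using assms by (auto intro!: exI [of _ "\<lambda>i. if i \<le> n then c i else 0"])

lemma psi_spanE:
  assumes "g \<in> psi_span n"
  obtains c where "\<And>i. is_laurent_poly (c i)" "\<And>k. k \<le> n \<Longrightarrow> g k = (\<Sum>i\<le>n. c i * psi n i k)"
  using assms unfolding psi_span_def by auto

lemma psi_span_cong: "g \<in> psi_span n \<Longrightarrow> (\<And>k. k \<le> n \<Longrightarrow> f k = g k) \<Longrightarrow> f \<in> psi_span n"
  unfolding psi_span_def by auto

lemma psi_span_0: "(\<lambda>k. 0) \<in> psi_span n"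
  by (rule psi_spanI [of _ "\<lambda>i. 0"]) auto

lemma psi_span_1: "(\<lambda>k. 1) \<in> psi_span n"
  by (rule psi_spanI [of _ "\<lambda>i. if i = 0 then 1 else 0"])
    (auto simp: psi_def if_distrib [of "\<lambda>x. x * _"] cong: if_cong)

lemma psi_span_add:
  assumes "f \<in> psi_span n" "g \<in> psi_span n"
  shows "(\<lambda>k. f k + g k) \<in> psi_span n"
proof -
  obtain c where c: "\<And>i. is_laurent_poly (c i)"
    "\<And>k. k \<le> n \<Longrightarrow> f k = (\<Sum>i\<le>n. c i * psi n i k)"
    using assms(1) by (rule psi_spanE) blast
  obtain d where d: "\<And>i. is_laurent_poly (d i)"
    "\<And>k. k \<le> n \<Longrightarrow> g k = (\<Sum>i\<le>n. d i * psi n i k)"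
    using assms(2) by (rule psi_spanE) blast
  show ?thesis
    by (rule psi_spanI [of _ "\<lambda>i. c i + d i"]) (auto simp: c d sum.distrib algebra_simps)
qed

lemma psi_span_scale:
  assumes "is_laurent_poly x" "f \<in> psi_span n"
  shows "(\<lambda>k. x * f k) \<in> psi_span n"
proof -
  obtain c where c: "\<And>i. is_laurent_poly (c i)"
    "\<And>k. k \<le> n \<Longrightarrow> f k = (\<Sum>i\<le>n. c i * psi n i k)"
    using assms(2) by (rule psi_spanE) blast
  show ?thesis
    by (rule psi_spanI [of _ "\<lambda>i. x * c i"])
      (auto simp: c assms sum_distrib_left mult.assoc intro!: laurent_mult)
qed

lemma psi_span_sum:
  "(\<And>i. i \<in> I \<Longrightarrow> f i \<in> psi_span n) \<Longrightarrow> (\<lambda>k. \<Sum>i\<in>I. f i k) \<in> psi_span n"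
  by (induction I rule: infinite_finite_induct) (auto intro: psi_span_0 psi_span_add)

text \<open>By linearity, stability under multiplication by \<open>f\<close> need only be tested on
  the generators \<open>psi n i\<close>.\<close>

lemma psi_span_mult:
  assumes g: "g \<in> psi_span n" and f: "\<And>i. i \<le> n \<Longrightarrow> (\<lambda>k. f k * psi n i k) \<in> psi_span n"
  shows "(\<lambda>k. f k * g k) \<in> psi_span n"
proof -
  obtain c where c: "\<And>i. is_laurent_poly (c i)"
    "\<And>k. k \<le> n \<Longrightarrow> g k = (\<Sum>i\<le>n. c i * psi n i k)"
    using g by (rule psi_spanE) blast
  have "(\<lambda>k. \<Sum>i\<le>n. c i * (f k * psi n i k)) \<in> psi_span n"
    using c f by (intro psi_span_sum psi_span_scale) auto
  then show ?thesis
    by (rule psi_span_cong) (auto simp: c sum_distrib_left mult_ac)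
qed

section \<open>Expanding \<open>[2 n, n - k] psi_i(k)\<close> in the functions
  \<open>psi_l\<close>\<close>

text \<open>Only \<open>i <= l <= n - k\<close> contributes. With \<open>l = s + i\<close>,
  trinomial revision extracts \<open>[n - k, i]\<close> and leaves a sum of Vandermonde
  shape.\<close>

lemma sum_qbinom_psi:
  assumes "k + i \<le> n"
  shows "(\<Sum>l\<le>n. f l * qbinom l i * psi n l k) =
    qbinom (n - k) i *
      (\<Sum>s\<le>n - k - i. f (s + i) * qbinom (n - k - i) s * qbinom (n + k) (s + i))"
proof -
  have "(\<Sum>l\<le>n. f l * qbinom l i * psi n l k) = (\<Sum>l=i..n - k. f l * qbinom l i * psi n l k)"
    by (rule sum.mono_neutral_right) (auto simp: not_le)
  also have "\<dots> = (\<Sum>s\<le>n - k - i. f (s + i) * qbinom (s + i) i * psi n (s + i) k)"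
    by (rule sum.reindex_bij_witness [of _ "\<lambda>s. s + i" "\<lambda>l. l - i"]) (use assms in auto)
  also have "\<dots> = (\<Sum>s\<le>n - k - i. qbinom (n - k) i *
      (f (s + i) * qbinom (n - k - i) s * qbinom (n + k) (s + i)))"
  proof (intro sum.cong refl)
    fix s assume "s \<in> {..n - k - i}"
    then have eq: "qbinom (n - k) (s + i) * qbinom (s + i) i = qbinom (n - k) i * qbinom (n - k - i) s"
      using qbinom_trinomial [of i "s + i" "n - k"] assms by simp
    have "f (s + i) * qbinom (s + i) i * psi n (s + i) k =
      f (s + i) * (qbinom (n - k) (s + i) * qbinom (s + i) i) * qbinom (n + k) (s + i)"
      by (simp only: psi_def mult_ac)
    also have "\<dots> = qbinom (n - k) i * (f (s + i) * qbinom (n - k - i) s * qbinom (n + k) (s + i))"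
      unfolding eq by (simp only: mult_ac)
    finally show "f (s + i) * qbinom (s + i) i * psi n (s + i) k = \<dots>" .
  qed
  finally show ?thesis
    by (simp add: sum_distrib_left)
qed

text \<open>
  The coefficients in the expansion of \<open>q^(e k\<^sup>2) [2 n, n - k] \<psi>\<^sub>i(k)\<close>, for \<open>e = 0, 1\<close>, and of that product
  times \<open>[n - k] [n + k]\<close>, up to factors depending only on \<open>q\<close>-binomials and \<open>q\<close>-integers.
\<close>

definition wt :: "nat \<Rightarrow> nat \<Rightarrow> nat \<Rightarrow> nat \<Rightarrow> int poly fract" where
  "wt e n i l = qvar ^ (if e = 0 then l * (l - i) else (n - l)\<^sup>2)"

definition wt' :: "nat \<Rightarrow> nat \<Rightarrow> nat \<Rightarrow> nat \<Rightarrow> int poly fract" where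
  "wt' e n i l = qvar ^ (if e = 0 then (l - 1) * (l - i) else (n - l)\<^sup>2)"

lemma laurent_wt [simp]: "is_laurent_poly (wt e n i l)" "is_laurent_poly (wt' e n i l)"
  by (simp_all add: wt_def wt'_def)

text \<open>Since \<open>[2 n, n - k] [n + k, i] = [2 n, i] [2 n - i, n - k]\<close>, it remains to
  expand the last factor by Vandermonde with \<open>m = n - k - i\<close> and
  \<open>b = n + k\<close>: the first form for \<open>e = 0\<close>, the second for
  \<open>e = 1\<close>.\<close>

lemma qbinom_mult_psi:
  assumes "k \<le> n" "i \<le> n" "e \<le> 1"
  shows "qvar ^ (e * k\<^sup>2) * qbinom (2 * n) (n - k) * psi n i k =
    qbinom (2 * n) i * (\<Sum>l\<le>n. wt e n i l * qbinom l i * psi n l k)"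
proof (cases "k + i \<le> n")
  case True
  define m where "m = n - k - i"
  have n: "n = m + k + i"
    using True by (simp add: m_def)
  have vandermonde: "qvar ^ (e * k\<^sup>2) * qbinom (2 * n - i) (n - k) =
    (\<Sum>s\<le>m. wt e n i (s + i) * qbinom m s * qbinom (n + k) (s + i))"
  proof (cases "e = 0")
    case True
    then show ?thesis
      using qbinom_vandermonde [where m = m and i = i and b = "n + k"]
      by (simp add: wt_def n algebra_simps mult_2_right)
  next
    case False
    then have e: "e = 1"
      using assms by simp
    have "(\<Sum>s\<le>m. wt e n i (s + i) * qbinom m s * qbinom (n + k) (s + i)) =
      qvar ^ (k\<^sup>2) * (\<Sum>s\<le>m. qvar ^ ((m - s) * (n + k - i - s)) * qbinom m s * qbinom (n + k) (s + i))"
      unfolding sum_distrib_left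
    proof (intro sum.cong refl)
      fix s assume "s \<in> {..m}"
      then obtain d where d: "m = s + d"
        using le_Suc_ex by auto
      \<comment> \<open>The factor \<open>q^(k^2)\<close> completes the Vandermonde exponent to a
        square free of \<open>k\<close>, so the weight depends on \<open>l = s + i\<close>
        only.\<close>
      have "(n - (s + i))\<^sup>2 = k\<^sup>2 + (m - s) * (n + k - i - s)"
        by (simp add: n d power2_eq_square algebra_simps)
      then show "wt e n i (s + i) * qbinom m s * qbinom (n + k) (s + i) = qvar ^ k\<^sup>2 *
         (qvar ^ ((m - s) * (n + k - i - s)) * qbinom m s * qbinom (n + k) (s + i))"
        by (simp add: wt_def e power_add mult.assoc)
    qed
    then show ?thesis
      using qbinom_vandermonde' [of m "n + k" i] by (simp add: e n algebra_simps mult_2_right)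
  qed
  have swap: "qbinom (2 * n) (n - k) * qbinom (n + k) i = qbinom (2 * n) i * qbinom (2 * n - i) (n - k)"
  proof -
    have "2 * n - (n - k) = n + k" "2 * n - i - (n - k) = n + k - i" "n - k \<le> 2 * n - i"
      using True by simp_all
    then show ?thesis
      using True by (simp add: qbinom_def)
  qed
  have "qvar ^ (e * k\<^sup>2) * qbinom (2 * n) (n - k) * psi n i k =
      qvar ^ (e * k\<^sup>2) * qbinom (n - k) i * (qbinom (2 * n) (n - k) * qbinom (n + k) i)"
    by (simp only: psi_def mult_ac)
  also have "\<dots> = qbinom (2 * n) i *
      (qbinom (n - k) i * (qvar ^ (e * k\<^sup>2) * qbinom (2 * n - i) (n - k)))"
    unfolding swap by (simp only: mult_ac)
  also have "\<dots> = qbinom (2 * n) i * (\<Sum>l\<le>n. wt e n i l * qbinom l i * psi n l k)"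
    unfolding vandermonde sum_qbinom_psi [OF True] m_def [symmetric] ..
  finally show ?thesis .
next
  case False
  \<comment> \<open>If \<open>l < i\<close> then \<open>qbinom l i = 0\<close>; otherwise
    \<open>n - k < i <= l\<close> and \<open>psi n l k = 0\<close>.\<close>
  then have "wt e n i l * qbinom l i * psi n l k = 0" for l
    using assms(1) by (cases "l < i") auto
  moreover have "psi n i k = 0"
    using False assms(1) by auto
  ultimately show ?thesis
    by (simp only: mult_zero_right sum.neutral_const)
qed

section \<open>Multiplication by \<open>[n - k] [n + k]\<close>\<close>

text \<open>Split \<open>[n - k] [n + k] = q^l [n - k - l] [n + k - l] + [l] [2 n - l]\<close>; the
  first product raises \<open>l\<close> in both binomials by \<open>qbinom_step\<close>.\<close>

lemma qint_mult_psi: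
  assumes "k \<le> n" "l \<le> n"
  shows "qint (n - k) * qint (n + k) * psi n l k =
    qvar ^ l * (qint (Suc l))\<^sup>2 * psi n (Suc l) k + qint l * qint (2 * n - l) * psi n l k"
proof (cases "k + l \<le> n")
  case True
  have "(qint (Suc l))\<^sup>2 * psi n (Suc l) k =
      (qint (Suc l) * qbinom (n - k) (Suc l)) * (qint (Suc l) * qbinom (n + k) (Suc l))"
    by (simp add: psi_def power2_eq_square mult_ac)
  also have "\<dots> = qint (n - k - l) * qint (n + k - l) * psi n l k"
    unfolding qbinom_step by (simp add: psi_def mult_ac)
  finally have *: "(qint (Suc l))\<^sup>2 * psi n (Suc l) k = qint (n - k - l) * qint (n + k - l) * psi n l k" .
  obtain m where n: "n = m + k + l"
    using True by (metis add.commute add.left_commute le_Suc_ex)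
  have "qint (n - k) * qint (n + k) =
      qvar ^ l * (qint (n - k - l) * qint (n + k - l)) + qint l * qint (2 * n - l)"
  proof -
    have e: "n - k = m + l" "n + k = m + k + k + l" "m + l - l = m" "m + k + k + l - l = m + k + k"
        "2 * n - l = m + m + k + k + l"
      by (simp_all add: n)
    have "(1 - x * z) / d * ((1 - x * y * y * z) / d) =
        z * ((1 - x) / d * ((1 - x * y * y) / d)) + (1 - z) / d * ((1 - x * x * y * y * z) / d)"
      if "d \<noteq> 0" for x y z d :: "int poly fract"
      using that by (simp add: field_simps)
    from this [of "1 - qvar" "qvar ^ m" "qvar ^ l" "qvar ^ k"] show ?thesis
      unfolding e qint_def power_add by simp
  qed
  then show ?thesis
    by (simp add: mult.assoc * distrib_right)
qed (use assms in auto)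

text \<open>Comparison of coefficients: \<open>d\<close> collects what \<open>psi n (Suc l)\<close>
  receives from \<open>psi n l\<close> and from itself.\<close>

lemma qint_mult_sum_psi:
  assumes "k \<le> n"
    and "d 0 = 0"
    and d: "\<And>l. l < n \<Longrightarrow> d (Suc l) = c l * qvar ^ l * (qint (Suc l))\<^sup>2
      + c (Suc l) * qint (Suc l) * qint (2 * n - Suc l)"
  shows "qint (n - k) * qint (n + k) * (\<Sum>l\<le>n. c l * psi n l k) = (\<Sum>l\<le>n. d l * psi n l k)"
proof -
  have "qint (n - k) * qint (n + k) * (\<Sum>l\<le>n. c l * psi n l k) =
    (\<Sum>l\<le>n. c l * (qint (n - k) * qint (n + k) * psi n l k))"
    by (simp add: sum_distrib_left mult_ac)
  also have "\<dots> = (\<Sum>l\<le>n. c l * (qvar ^ l * (qint (Suc l))\<^sup>2 * psi n (Suc l) k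
      + qint l * qint (2 * n - l) * psi n l k))"
    by (rule sum.cong) (use assms(1) in \<open>auto simp: qint_mult_psi\<close>)
  also have "\<dots> = (\<Sum>l\<le>n. c l * qvar ^ l * (qint (Suc l))\<^sup>2 * psi n (Suc l) k)
      + (\<Sum>l\<le>n. c l * qint l * qint (2 * n - l) * psi n l k)"
    by (simp add: distrib_left sum.distrib mult.assoc)
  \<comment> \<open>The term \<open>l = n\<close> drops out because
    \<open>psi n (Suc n) k = 0\<close>; in the other sum the term \<open>l = 0\<close> drops out
    because \<open>qint 0 = 0\<close>.\<close>
  also have "(\<Sum>l\<le>n. c l * qvar ^ l * (qint (Suc l))\<^sup>2 * psi n (Suc l) k) =
      (\<Sum>l<n. c l * qvar ^ l * (qint (Suc l))\<^sup>2 * psi n (Suc l) k)"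
    by (simp flip: lessThan_Suc_atMost)
  also have "(\<Sum>l\<le>n. c l * qint l * qint (2 * n - l) * psi n l k) =
      (\<Sum>l<n. c (Suc l) * qint (Suc l) * qint (2 * n - Suc l) * psi n (Suc l) k)"
    by (simp add: sum.atMost_shift)
  also have "(\<Sum>l<n. c l * qvar ^ l * (qint (Suc l))\<^sup>2 * psi n (Suc l) k) + \<dots> =
      (\<Sum>l<n. d (Suc l) * psi n (Suc l) k)"
    unfolding sum.distrib [symmetric] by (rule sum.cong) (auto simp: d distrib_right)
  also have "\<dots> = (\<Sum>l\<le>n. d l * psi n l k)"
    by (simp add: sum.atMost_shift assms(2))
  finally show ?thesis .
qed

text \<open>The weights are made so that the two contributions recombine through
  \<open>[x + y] = [x] + q^x [y]\<close>, where \<open>x\<close> and \<open>y\<close> are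
  \<open>Suc l - i\<close> and \<open>2 * n - Suc l\<close>, in this order for \<open>e = 0\<close>
  and in the opposite order for \<open>e = 1\<close>.\<close>

lemma wt_step:
  assumes "i \<le> Suc l" "l < n" "e \<le> 1"
  shows "wt e n i l * qvar ^ l * qint (Suc l - i) + wt e n i (Suc l) * qint (2 * n - Suc l) =
    wt' e n i (Suc l) * qint (2 * n - i)"
proof (cases "e = 0")
  case True
  obtain c where c: "Suc l = c + i"
    using assms by (metis add.commute le_Suc_ex)
  have "qint (2 * n - i) = qint (Suc l - i) + qvar ^ (Suc l - i) * qint (2 * n - Suc l)"
    using qint_add [of "Suc l - i" "2 * n - Suc l"] assms by simp
  \<comment> \<open>For \<open>i = Suc l\<close> truncation can spoil this exponent identity, but
    then \<open>qint (Suc l - i)\<close> is zero.\<close>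
  moreover have "l * (l - i) + l = l * (Suc l - i)" if "i \<le> l"
    using that by (simp add: Suc_diff_le)
  then have "qvar ^ (l * (l - i)) * qvar ^ l * qint (Suc l - i) =
      qvar ^ (l * (Suc l - i)) * qint (Suc l - i)"
    using assms by (cases "i \<le> l") (auto simp flip: power_add simp: not_le)
  moreover have "Suc l * (Suc l - i) = l * (Suc l - i) + (Suc l - i)"
    by simp
  then have "qvar ^ (Suc l * (Suc l - i)) = qvar ^ (l * (Suc l - i)) * qvar ^ (Suc l - i)"
    by (simp only: power_add)
  ultimately show ?thesis
    using True by (simp add: wt_def wt'_def distrib_left mult.assoc del: power_Suc mult_Suc)
next
  case False
  obtain d where n: "n = Suc l + d"
    using assms by (metis less_iff_Suc_add add_Suc)
  have "qint (2 * n - i) = qint (2 * n - Suc l) + qvar ^ (2 * n - Suc l) * qint (Suc l - i)"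
    using qint_add [of "2 * n - Suc l" "Suc l - i"] assms by simp
  moreover have "(n - l)\<^sup>2 + l = (n - Suc l)\<^sup>2 + (2 * n - Suc l)"
    by (simp add: n power2_eq_square)
  then have "qvar ^ ((n - l)\<^sup>2) * qvar ^ l = qvar ^ ((n - Suc l)\<^sup>2) * qvar ^ (2 * n - Suc l)"
    by (metis power_add)
  ultimately show ?thesis
    using False by (simp add: wt_def wt'_def distrib_left mult.assoc [symmetric] del: power_Suc mult_Suc)
qed

text \<open>Source of the first factor \<open>[2 n]\<close>: all new coefficients contain
  \<open>[2 n - i]\<close>, which \<open>[2 n, i]\<close> absorbs. The leftover \<open>[l]\<close>
  is kept next to \<open>psi n l\<close> because it produces the second factor.\<close>

lemma qint_qbinom_mult_psi:
  assumes "n > 0" "k \<le> n" "i \<le> n" "e \<le> 1"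
  shows "qint (n - k) * qint (n + k) * (qvar ^ (e * k\<^sup>2) * qbinom (2 * n) (n - k) * psi n i k) =
    qint (2 * n) * (\<Sum>l\<le>n. qbinom (2 * n - 1) i * wt' e n i l * qbinom l i * (qint l * psi n l k))"
proof -
  have sum_eq: "qint (n - k) * qint (n + k) * (\<Sum>l\<le>n. (wt e n i l * qbinom l i) * psi n l k) =
      (\<Sum>l\<le>n. (qint (2 * n - i) * wt' e n i l * qbinom l i * qint l) * psi n l k)"
  proof (rule qint_mult_sum_psi)
    fix l assume l: "l < n"
    show "qint (2 * n - i) * wt' e n i (Suc l) * qbinom (Suc l) i * qint (Suc l) =
         wt e n i l * qbinom l i * qvar ^ l * (qint (Suc l))\<^sup>2 +
         wt e n i (Suc l) * qbinom (Suc l) i * qint (Suc l) * qint (2 * n - Suc l)"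
    proof (cases "i \<le> Suc l")
      case True
      have "wt e n i l * qbinom l i * qvar ^ l * (qint (Suc l))\<^sup>2 =
          wt e n i l * qvar ^ l * qint (Suc l) * (qint (Suc l) * qbinom l i)"
        by (simp add: power2_eq_square mult_ac)
      also have "\<dots> = (wt e n i l * qvar ^ l * qint (Suc l - i)) * qbinom (Suc l) i * qint (Suc l)"
        unfolding qbinom_absorb_comp [symmetric] by (simp add: mult_ac)
      finally have *: "wt e n i l * qbinom l i * qvar ^ l * (qint (Suc l))\<^sup>2 = \<dots>" .
      have "qint (2 * n - i) * wt' e n i (Suc l) * qbinom (Suc l) i * qint (Suc l) =
          (wt' e n i (Suc l) * qint (2 * n - i)) * qbinom (Suc l) i * qint (Suc l)"
        by (simp add: mult_ac)
      also have "\<dots> = wt e n i l * qvar ^ l * qint (Suc l - i) * qbinom (Suc l) i * qint (Suc l)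
          + wt e n i (Suc l) * qbinom (Suc l) i * qint (Suc l) * qint (2 * n - Suc l)"
        unfolding wt_step [OF True l \<open>e \<le> 1\<close>, symmetric] by (simp add: mult_ac distrib_left [where ?'a = "int poly fract"])
      finally show ?thesis
        unfolding * .
    qed auto
  qed (use assms in auto)
  have absorb: "qbinom (2 * n) i * qint (2 * n - i) = qint (2 * n) * qbinom (2 * n - 1) i"
    using qbinom_absorb_comp [of "2 * n - 1" i] \<open>n > 0\<close> by (simp add: mult.commute)
  have "qint (n - k) * qint (n + k) * (qvar ^ (e * k\<^sup>2) * qbinom (2 * n) (n - k) * psi n i k) =
      qbinom (2 * n) i *
        (qint (n - k) * qint (n + k) * (\<Sum>l\<le>n. (wt e n i l * qbinom l i) * psi n l k))"
    unfolding qbinom_mult_psi [OF assms(2-4)] by (simp only: mult_ac)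
  also have "\<dots> = (\<Sum>l\<le>n. (qbinom (2 * n) i * qint (2 * n - i)) *
      (wt' e n i l * qbinom l i * (qint l * psi n l k)))"
    unfolding sum_eq unfolding sum_distrib_left by (simp only: mult_ac)
  also have "\<dots> = qint (2 * n) *
      (\<Sum>l\<le>n. qbinom (2 * n - 1) i * wt' e n i l * qbinom l i * (qint l * psi n l k))"
    unfolding absorb sum_distrib_left by (simp only: mult_ac)
  finally show ?thesis .
qed

section \<open>Stability of the span under the factors of the summand\<close>

lemma psi_span_mult_qbinom:
  assumes "e \<le> 1" "g \<in> psi_span n"
  shows "(\<lambda>k. qvar ^ (e * k\<^sup>2) * qbinom (2 * n) (n - k) * g k) \<in> psi_span n"
proof (rule psi_span_mult [OF assms(2)])
  fix i assume i: "i \<le> n"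
  show "(\<lambda>k. qvar ^ (e * k\<^sup>2) * qbinom (2 * n) (n - k) * psi n i k) \<in> psi_span n"
  proof (rule psi_spanI [of _ "\<lambda>l. qbinom (2 * n) i * (wt e n i l * qbinom l i)"])
    fix k assume "k \<le> n"
    then show "qvar ^ (e * k\<^sup>2) * qbinom (2 * n) (n - k) * psi n i k =
        (\<Sum>l\<le>n. qbinom (2 * n) i * (wt e n i l * qbinom l i) * psi n l k)"
      using qbinom_mult_psi [of k n i e] i assms(1) by (simp add: sum_distrib_left mult.assoc)
  qed (auto intro!: laurent_mult)
qed

text \<open>Source of the second factor \<open>[2 n]\<close>: expanding the product brings out
  \<open>[2 n, l]\<close>, and \<open>[l] [2 n, l] = [2 n] [2 n - 1, l - 1]\<close>. For
  \<open>l = 0\<close> the function is zero.\<close>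

lemma psi_span_qint_qbinom_psi:
  assumes "n > 0" "e \<le> 1" "l \<le> n"
  shows "(\<lambda>k. qvar ^ (e * k\<^sup>2) * qbinom (2 * n) (n - k) * (qint l * psi n l k) / qint (2 * n))
    \<in> psi_span n"
proof (cases l)
  case 0
  then show ?thesis
    by (simp add: psi_span_0)
next
  case (Suc l')
  have "qint l * qbinom (2 * n) l = qint (2 * n) * qbinom (2 * n - 1) l'"
    using qbinom_absorb [of l' "2 * n - 1"] \<open>n > 0\<close> by (simp add: Suc)
  then have *: "qint l * qbinom (2 * n) l / qint (2 * n) = qbinom (2 * n - 1) l'"
    using \<open>n > 0\<close> by (simp add: field_simps)
  show ?thesis
  proof (rule psi_spanI [of _ "\<lambda>m. qbinom (2 * n - 1) l' * (wt e n l m * qbinom m l)"])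
    fix k assume k: "k \<le> n"
    have "qvar ^ (e * k\<^sup>2) * qbinom (2 * n) (n - k) * (qint l * psi n l k) / qint (2 * n) =
      qint l / qint (2 * n) * (qvar ^ (e * k\<^sup>2) * qbinom (2 * n) (n - k) * psi n l k)"
      by simp
    also have "\<dots> = (qint l * qbinom (2 * n) l / qint (2 * n)) *
      (\<Sum>m\<le>n. wt e n l m * qbinom m l * psi n m k)"
      unfolding qbinom_mult_psi [OF k assms(3,2)] by simp
    also have "\<dots> = (\<Sum>m\<le>n. qbinom (2 * n - 1) l' * (wt e n l m * qbinom m l) * psi n m k)"
      unfolding * by (simp add: sum_distrib_left mult.assoc)
    finally show "qvar ^ (e * k\<^sup>2) * qbinom (2 * n) (n - k) * (qint l * psi n l k) / qint (2 * n) = \<dots>" .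
  qed (auto intro!: laurent_mult)
qed

text \<open>The two binomials act one after the other: the one with \<open>e'\<close>, together with
  \<open>[n - k] [n + k]\<close>, yields \<open>[2 n]\<close> and the factors \<open>[l]\<close>;
  the one with \<open>e\<close> turns these into the second \<open>[2 n]\<close>.\<close>

lemma psi_span_mult_qint_qbinom:
  assumes "n > 0" "e \<le> 1" "e' \<le> 1" "g \<in> psi_span n"
  shows "(\<lambda>k. qvar ^ (e * k\<^sup>2) * qbinom (2 * n) (n - k) *
      (qint (n - k) * qint (n + k) * (qvar ^ (e' * k\<^sup>2) * qbinom (2 * n) (n - k))) /
      (qint (2 * n))\<^sup>2 * g k) \<in> psi_span n"
proof (rule psi_span_mult [OF assms(4)])
  fix i assume i: "i \<le> n"
  have "(\<lambda>k. \<Sum>l\<le>n. qbinom (2 * n - 1) i * wt' e' n i l * qbinom l i *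
      (qvar ^ (e * k\<^sup>2) * qbinom (2 * n) (n - k) * (qint l * psi n l k) / qint (2 * n))) \<in> psi_span n"
    using assms by (intro psi_span_sum psi_span_scale psi_span_qint_qbinom_psi laurent_mult) auto
  then show "(\<lambda>k. qvar ^ (e * k\<^sup>2) * qbinom (2 * n) (n - k) *
      (qint (n - k) * qint (n + k) * (qvar ^ (e' * k\<^sup>2) * qbinom (2 * n) (n - k))) /
      (qint (2 * n))\<^sup>2 * psi n i k) \<in> psi_span n"
  proof (rule psi_span_cong)
    fix k assume k: "k \<le> n"
    let ?U = "qvar ^ (e * k\<^sup>2) * qbinom (2 * n) (n - k)"
    let ?S = "\<Sum>l\<le>n. qbinom (2 * n - 1) i * wt' e' n i l * qbinom l i * (qint l * psi n l k)"
    have "?U * (qint (n - k) * qint (n + k) * (qvar ^ (e' * k\<^sup>2) * qbinom (2 * n) (n - k))) /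
        (qint (2 * n))\<^sup>2 * psi n i k =
      ?U / (qint (2 * n))\<^sup>2 *
        (qint (n - k) * qint (n + k) * (qvar ^ (e' * k\<^sup>2) * qbinom (2 * n) (n - k) * psi n i k))"
      by simp
    also have "\<dots> = ?U / (qint (2 * n))\<^sup>2 * (qint (2 * n) * ?S)"
      unfolding qint_qbinom_mult_psi [OF assms(1) k i assms(3)] ..
    also have "\<dots> = ?U / qint (2 * n) * ?S"
      using \<open>n > 0\<close> by (simp add: power2_eq_square)
    also have "\<dots> = (\<Sum>l\<le>n. qbinom (2 * n - 1) i * wt' e' n i l * qbinom l i *
        (?U * (qint l * psi n l k) / qint (2 * n)))"
      by (simp add: sum_distrib_left mult_ac)
    finally show "?U * (qint (n - k) * qint (n + k) * (qvar ^ (e' * k\<^sup>2) * qbinom (2 * n) (n - k))) /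
        (qint (2 * n))\<^sup>2 * psi n i k = \<dots>" .
  qed
qed

section \<open>Even powers of \<open>B\<close>\<close>

text \<open>A \<open>q\<close>-analogue of \<open>k^2 = n^2 - (n - k) (n + k)\<close>. The factor
  \<open>q^k\<close> on the right cancels the denominator in \<open>Bpoly_square\<close>.\<close>

lemma qint_square:
  assumes "k \<le> n"
  shows "qvar ^ n * (qint k)\<^sup>2 = qvar ^ k * ((qint n)\<^sup>2 - qint (n - k) * qint (n + k))"
proof -
  obtain m where n: "n = k + m"
    using assms le_Suc_ex by auto
  have e: "k + m + k = k + k + m" "k + m - k = m"
    by simp_all
  have "x * y * ((1 - x) / d)\<^sup>2 = x * (((1 - x * y) / d)\<^sup>2 - (1 - y) / d * ((1 - x * x * y) / d))"
    if "d \<noteq> 0" for x y d :: "int poly fract"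
    using that by (simp add: field_simps power2_eq_square)
  from this [of "1 - qvar" "qvar ^ k" "qvar ^ m"] show ?thesis
    unfolding n e qint_def power_add by simp
qed

text \<open>By \<open>[2 n] = (1 + q^n) [n]\<close>, the denominator \<open>[n]^2\<close> is traded
  for \<open>[2 n]^2\<close>, which the two binomials can absorb, at the cost of a polynomial
  factor.\<close>

lemma Bpoly_square:
  assumes "k \<le> n" "n > 0"
  shows "(Bpoly n k)\<^sup>2 / qvar ^ k = inverse (qvar ^ n) *
    ((qbinom (2 * n) (n - k))\<^sup>2 - (1 + qvar ^ n)\<^sup>2 *
      (qint (n - k) * qint (n + k) * (qbinom (2 * n) (n - k))\<^sup>2 / (qint (2 * n))\<^sup>2))"
proof -
  have nz: "1 + qvar ^ n \<noteq> 0"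
    using qint_double [of n] \<open>n > 0\<close> by auto
  have "(Bpoly n k)\<^sup>2 / qvar ^ k = inverse (qvar ^ n) * (qvar ^ n * (qint k)\<^sup>2) / (qint n)\<^sup>2
      * (qbinom (2 * n) (n - k))\<^sup>2 / qvar ^ k"
    by (simp add: Bpoly_def power_mult_distrib power_divide)
  also have "\<dots> = inverse (qvar ^ n) * ((qint n)\<^sup>2 - qint (n - k) * qint (n + k)) / (qint n)\<^sup>2
      * (qbinom (2 * n) (n - k))\<^sup>2"
    unfolding qint_square [OF assms(1)] by simp
  also have "\<dots> = inverse (qvar ^ n) *
    ((qbinom (2 * n) (n - k))\<^sup>2 - (1 + qvar ^ n)\<^sup>2 *
      (qint (n - k) * qint (n + k) * (qbinom (2 * n) (n - k))\<^sup>2 / (qint (2 * n))\<^sup>2))"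
    using nz \<open>n > 0\<close> by (simp add: qint_double power_mult_distrib diff_divide_distrib left_diff_distrib)
      (simp add: field_simps)
  finally show ?thesis .
qed

lemma psi_span_mult_Bpoly_square:
  assumes "n > 0" "e \<le> 2" "g \<in> psi_span n"
  shows "(\<lambda>k. (Bpoly n k)\<^sup>2 / qvar ^ k * qvar ^ (e * k\<^sup>2) * g k) \<in> psi_span n"
proof -
  \<comment> \<open>Each of the two binomials in the square can carry at most one factor
    \<open>q^(k^2)\<close>.\<close>
  obtain d d' where d: "d \<le> 1" "d' \<le> 1" "e = d + d'"
    using that [of "min e 1" "e - 1"] assms(2) by force
  let ?U = "\<lambda>d k. qvar ^ (d * k\<^sup>2) * qbinom (2 * n) (n - k)"
  have "(\<lambda>k. inverse (qvar ^ n) * (?U d k * (?U d' k * g k) + (- ((1 + qvar ^ n)\<^sup>2)) *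
      (?U d k * (qint (n - k) * qint (n + k) * ?U d' k) / (qint (2 * n))\<^sup>2 * g k))) \<in> psi_span n"
    using assms d laurent_power [OF laurent_add [OF laurent_1 laurent_qvar_power]]
    by (intro psi_span_scale psi_span_add psi_span_mult_qbinom psi_span_mult_qint_qbinom
        laurent_uminus) auto
  then show ?thesis
  proof (rule psi_span_cong)
    fix k assume "k \<le> n"
    show "(Bpoly n k)\<^sup>2 / qvar ^ k * qvar ^ (e * k\<^sup>2) * g k =
      inverse (qvar ^ n) * (?U d k * (?U d' k * g k) + (- ((1 + qvar ^ n)\<^sup>2)) *
      (?U d k * (qint (n - k) * qint (n + k) * ?U d' k) / (qint (2 * n))\<^sup>2 * g k))"
      unfolding Bpoly_square [OF \<open>k \<le> n\<close> \<open>n > 0\<close>] d(3) distrib_right power_add power2_eq_square [of "qbinom (2 * n) (n - k)"]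
      by (simp add: algebra_simps)
  qed
qed

lemma psi_span_Bpoly_power:
  assumes "n > 0" "j \<le> 2 * r"
  shows "(\<lambda>k. ((Bpoly n k)\<^sup>2 / qvar ^ k) ^ r * qvar ^ (j * k\<^sup>2)) \<in> psi_span n"
  using assms(2)
proof (induction r arbitrary: j)
  case 0
  then show ?case
    by (simp add: psi_span_1)
next
  case (Suc r)
  \<comment> \<open>One square takes up to two factors \<open>q^(k^2)\<close>; at most
    \<open>2 * r\<close> are left for the other \<open>r\<close> squares.\<close>
  define e where "e = min j 2"
  have e: "e \<le> 2" "j - e \<le> 2 * r" "j = e + (j - e)"
    using Suc.prems by (auto simp: e_def)
  show ?case
    by (rule psi_span_cong [OF psi_span_mult_Bpoly_square [OF \<open>n > 0\<close> e(1) Suc.IH [OF e(2)]]])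
      (subst e(3), simp only: power_Suc distrib_right power_add mult_ac)
qed

subsection \<open>The telescoping sum\<close>

text \<open>Three absorptions move \<open>[n + k + 1 - i]\<close> to \<open>[n + k + 1]\<close>,
  then to \<open>[n - k]\<close>, then to \<open>[n - k - i]\<close>.\<close>

lemma qbinom_psi_step:
  assumes "k < n"
  shows "qint (Suc n + k - i) * qbinom (2 * n) (n - Suc k) * psi n i (Suc k) =
    qint (n - k - i) * qbinom (2 * n) (n - k) * psi n i k"
proof -
  obtain m where m: "n - k = Suc m"
    using assms by (metis Suc_diff_Suc)
  then have m': "n - Suc k = m"
    by simp
  have "2 * n - m = Suc (n + k)"
    using m assms by simp
  then have P: "qint (Suc m) * qbinom (2 * n) (Suc m) = qint (Suc (n + k)) * qbinom (2 * n) m"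
    by (simp add: qbinom_step)
  have "qint (Suc n + k - i) * qbinom (2 * n) (n - Suc k) * psi n i (Suc k) =
      qbinom (2 * n) m * qbinom m i * (qint (Suc (n + k) - i) * qbinom (Suc (n + k)) i)"
    by (simp add: psi_def m' mult_ac)
  also have "\<dots> = (qint (Suc (n + k)) * qbinom (2 * n) m) * qbinom m i * qbinom (n + k) i"
    unfolding qbinom_absorb_comp by (simp add: mult_ac)
  also have "\<dots> = qbinom (2 * n) (Suc m) * (qint (Suc m) * qbinom m i) * qbinom (n + k) i"
    unfolding P [symmetric] by (simp add: mult_ac)
  also have "\<dots> = qint (n - k - i) * qbinom (2 * n) (n - k) * psi n i k"
    unfolding qbinom_absorb_comp [symmetric] by (simp add: psi_def m mult_ac)
  finally show ?thesis .
qed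

text \<open>By \<open>qbinom_psi_step\<close>, \<open>H k\<close> and \<open>H (Suc k)\<close> are
  \<open>[n + k - i]\<close> and \<open>[n - k - i]\<close> times the same product. Their
  difference, weighted by \<open>y\<close>, yields \<open>[2 k] = (1 + q^k) [k]\<close> up to a
  power of \<open>q\<close>, which is the numerator of the summand.\<close>

lemma Bpoly_psi_telescope:
  assumes "n > 0" "a \<le> n" "i \<le> n" "e \<le> 1"
  shows "(\<Sum>k=a..n. (1 + qvar ^ k) * Bpoly n k / qvar ^ k * qvar ^ (e * k\<^sup>2) * psi n i k) =
    (if e = 0 then inverse (qvar ^ (n - i)) else qvar ^ (a\<^sup>2 - a)) *
      qbinom (n - a) i * qbinom (n + a - 1) i * ((1 + qvar ^ n) * qbinom (2 * n - 1) (n - a))"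
proof -
  define x where "x = (if e = 0 then inverse (qvar ^ (n - i)) else 1)"
  define y where "y k = (if e = 0 then 1 else qvar ^ (k\<^sup>2 - k))" for k :: nat
  \<comment> \<open>The value 0 beyond \<open>n\<close> is imposed because truncation would leave
    \<open>H (Suc n)\<close> nonzero for \<open>i = 0\<close>; it removes the upper boundary
    term.\<close>
  define H where "H k = (if k \<le> n then qint (n + k - i) * qbinom (2 * n) (n - k) * psi n i k else 0)" for k
  have H_Suc: "H (Suc k) = qint (n - k - i) * qbinom (2 * n) (n - k) * psi n i k" if "k \<le> n" for k
    using qbinom_psi_step [of k n i] that by (cases "k = n") (auto simp: H_def)
  have term_eq: "(1 + qvar ^ k) * Bpoly n k / qvar ^ k * qvar ^ (e * k\<^sup>2) * psi n i k =
      x / qint n * (y k * H k - y (Suc k) * H (Suc k))" if k: "k \<le> n" for k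
  proof (cases "k + i \<le> n")
    case True
    then obtain m where n: "n = m + k + i"
      by (metis add.commute add.assoc le_Suc_ex)
    have x_eq: "x * (y k * qint (n + k - i) - y (Suc k) * qint (n - k - i)) =
        qint (2 * k) / qvar ^ k * qvar ^ (e * k\<^sup>2)"
    proof (cases "e = 0")
      case True
      \<comment> \<open>Here \<open>m = n - i - k\<close>, so \<open>x = q^(-(n - i))\<close> turns
        \<open>q^m\<close> into \<open>q^(-k)\<close>.\<close>
      have "qint (n + k - i) - qint (n - k - i) = qvar ^ m * qint (2 * k)"
        using qint_add [of m "2 * k"] by (simp add: n mult_2 add.assoc)
      then show ?thesis
        using True by (simp add: x_def y_def n power_add field_simps)
    next
      case False
      have "qint (n + k - i) - qvar ^ (2 * k) * qint (n - k - i) = qint (2 * k)"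
      proof -
        have "n + k - i = 2 * k + m" "n - k - i = m"
          by (simp_all add: n)
        then show ?thesis
          by (simp add: qint_add)
      qed
      moreover have "k\<^sup>2 = (k\<^sup>2 - k) + k"
        by (cases k) (simp_all add: power2_eq_square)
      then have "qvar ^ (k\<^sup>2) = qvar ^ (k\<^sup>2 - k) * qvar ^ k"
        by (metis power_add)
      \<comment> \<open>Thus \<open>y (Suc k) = q^(2 k) y k\<close>, the ratio needed for the
        difference just computed.\<close>
      moreover have "(Suc k)\<^sup>2 - Suc k = (k\<^sup>2 - k) + 2 * k"
        by (cases k) (simp_all add: power2_eq_square)
      then have "qvar ^ ((Suc k)\<^sup>2 - Suc k) = qvar ^ (k\<^sup>2 - k) * qvar ^ (2 * k)"
        by (metis power_add)
      moreover have "e = 1"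
        using False assms by simp
      ultimately show ?thesis
        by (simp add: x_def y_def right_diff_distrib [symmetric] mult.assoc)
    qed
    have "(1 + qvar ^ k) * Bpoly n k / qvar ^ k * qvar ^ (e * k\<^sup>2) * psi n i k =
        (qint (2 * k) / qvar ^ k * qvar ^ (e * k\<^sup>2)) / qint n * (qbinom (2 * n) (n - k) * psi n i k)"
      unfolding Bpoly_def qint_double times_divide_eq_left times_divide_eq_right divide_divide_eq_left
      by (simp only: mult_ac)
    also have "\<dots> = x / qint n * ((y k * qint (n + k - i) - y (Suc k) * qint (n - k - i)) *
        (qbinom (2 * n) (n - k) * psi n i k))"
      unfolding x_eq [symmetric] by simp
    also have "\<dots> = x / qint n * (y k * H k - y (Suc k) * H (Suc k))"
      unfolding H_Suc [OF k] using k by (simp add: H_def left_diff_distrib mult.assoc)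
    finally show ?thesis .
  next
    case False
    with k show ?thesis
      unfolding H_Suc [OF k] by (simp add: H_def)
  qed
  have "(\<Sum>k=a..n. (1 + qvar ^ k) * Bpoly n k / qvar ^ k * qvar ^ (e * k\<^sup>2) * psi n i k) =
      x / qint n * (\<Sum>k=a..n. y k * H k - y (Suc k) * H (Suc k))"
    unfolding sum_distrib_left by (rule sum.cong [OF refl], rule term_eq) simp
  also have "(\<Sum>k=a..n. y k * H k - y (Suc k) * H (Suc k)) = y a * H a - y (Suc n) * H (Suc n)"
    using sum_Suc_diff [of a n "\<lambda>k. - (y k * H k)"] \<open>a \<le> n\<close> by simp
  also have "\<dots> = y a * (qint (n + a - i) * qbinom (n + a) i) * qbinom (n - a) i * qbinom (2 * n) (n - a)"
    using \<open>a \<le> n\<close> by (simp add: H_def psi_def mult_ac)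
  also have "qint (n + a - i) * qbinom (n + a) i = qint (n + a) * qbinom (n + a - 1) i"
    using qbinom_absorb_comp [of "n + a - 1" i] \<open>n > 0\<close> by simp
  also have "x / qint n * (y a * (qint (n + a) * qbinom (n + a - 1) i) * qbinom (n - a) i * qbinom (2 * n) (n - a)) =
      x * y a * qbinom (n - a) i * qbinom (n + a - 1) i * (qint (n + a) * qbinom (2 * n) (n - a)) / qint n"
    by simp
  \<comment> \<open>The modulus appears: \<open>[2 n] / [n] = 1 + q^n\<close> multiplies
    \<open>[2 n - 1, n - a]\<close>.\<close>
  also have "qint (n + a) * qbinom (2 * n) (n - a) = qint (2 * n) * qbinom (2 * n - 1) (n - a)"
    using qbinom_absorb_comp [of "2 * n - 1" "n - a"] assms by (simp add: mult_2)
  finally show ?thesis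
    using \<open>n > 0\<close> by (simp add: qint_double x_def y_def)
qed

section \<open>Assembling the congruence\<close>

theorem theorem1p5:
  fixes n a r :: nat and j :: int
  assumes "n > 0" and "a \<le> n" and "0 \<le> j" and "j \<le> 2 * int r + 1"
  shows "laurent_cong_0
           (\<Sum>k=a..n. (1 + qvar ^ k) * Bpoly n k ^ (2 * r + 1)
               * qvar powi (j * (int k)\<^sup>2 - (int r + 1) * int k))
           ((1 + qvar ^ n) * qbinom (2 * n - 1) (n - a))"
proof -
  let ?D = "(1 + qvar ^ n) * qbinom (2 * n - 1) (n - a)"
  \<comment> \<open>Only the extreme case \<open>j = 2 r + 1\<close> exceeds what the
    \<open>r\<close> squares can carry; the extra \<open>q^(k^2)\<close> goes into the telescoping
    factor.\<close>
  define e where "e = (if j = 2 * int r + 1 then 1 else 0 :: nat)"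
  define j' where "j' = nat j - e"
  have j: "j = int (e + j')" "e \<le> 1" "j' \<le> 2 * r"
    using assms(3,4) by (auto simp: e_def j'_def)
  define g where "g k = ((Bpoly n k)\<^sup>2 / qvar ^ k) ^ r * qvar ^ (j' * k\<^sup>2)" for k
  have "g \<in> psi_span n"
    unfolding g_def by (rule psi_span_Bpoly_power) (use assms j in auto)
  then obtain c where c: "\<And>i. is_laurent_poly (c i)"
    "\<And>k. k \<le> n \<Longrightarrow> g k = (\<Sum>i\<le>n. c i * psi n i k)"
    by (rule psi_spanE) blast
  define b where
    "b i = (if e = 0 then inverse (qvar ^ (n - i)) else qvar ^ (a\<^sup>2 - a)) *
      qbinom (n - a) i * qbinom (n + a - 1) i" for i
  have b: "is_laurent_poly (b i)" for i
    by (auto simp: b_def intro!: laurent_mult)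
  have "(\<Sum>k=a..n. (1 + qvar ^ k) * Bpoly n k ^ (2 * r + 1)
               * qvar powi (j * (int k)\<^sup>2 - (int r + 1) * int k)) =
    (\<Sum>k=a..n. (1 + qvar ^ k) * Bpoly n k / qvar ^ k * qvar ^ (e * k\<^sup>2) * g k)"
  proof (rule sum.cong [OF refl])
    fix k
    \<comment> \<open>The power \<open>q^(-(r + 1) k)\<close> is shared out: one
      \<open>q^(-k)\<close> for each of the \<open>r\<close> squares and one for the telescoping
      factor.\<close>
    have "qvar powi (j * (int k)\<^sup>2 - (int r + 1) * int k) =
        qvar powi (int ((e + j') * k\<^sup>2) - int (k * r + k))"
      by (simp add: j(1) algebra_simps)
    also have "\<dots> = qvar ^ ((e + j') * k\<^sup>2) / qvar ^ (k * r + k)"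
      by (simp only: power_int_diff [OF disjI1 [OF qvar_nonzero]] power_int_of_nat)
    finally have powi_eq: "qvar powi (j * (int k)\<^sup>2 - (int r + 1) * int k) = \<dots>" .
    have Bpoly_eq: "Bpoly n k ^ (2 * r + 1) = Bpoly n k * ((Bpoly n k)\<^sup>2) ^ r"
      by (simp add: power_mult)
    show "(1 + qvar ^ k) * Bpoly n k ^ (2 * r + 1)
               * qvar powi (j * (int k)\<^sup>2 - (int r + 1) * int k) =
        (1 + qvar ^ k) * Bpoly n k / qvar ^ k * qvar ^ (e * k\<^sup>2) * g k"
      unfolding powi_eq Bpoly_eq
      by (simp add: g_def power_divide power_mult power_add distrib_right [of e] mult_ac)
  qed
  also have "\<dots> = (\<Sum>k=a..n. \<Sum>i\<le>n. c i *
      ((1 + qvar ^ k) * Bpoly n k / qvar ^ k * qvar ^ (e * k\<^sup>2) * psi n i k))"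
    by (rule sum.cong) (auto simp: c sum_distrib_left sum_divide_distrib mult_ac)
  also have "\<dots> = (\<Sum>i\<le>n. c i *
      (\<Sum>k=a..n. (1 + qvar ^ k) * Bpoly n k / qvar ^ k * qvar ^ (e * k\<^sup>2) * psi n i k))"
    by (subst sum.swap) (simp add: sum_distrib_left)
  also have "\<dots> = (\<Sum>i\<le>n. c i * (b i * ?D))"
    unfolding b_def
    by (intro sum.cong refl arg_cong2 [where f = "(*)"] Bpoly_psi_telescope) (use assms j in auto)
  also have "\<dots> = (\<Sum>i\<le>n. c i * b i) * ?D"
    by (simp add: sum_distrib_right mult.assoc)
  finally have sum_eq: "(\<Sum>k=a..n. (1 + qvar ^ k) * Bpoly n k ^ (2 * r + 1)
               * qvar powi (j * (int k)\<^sup>2 - (int r + 1) * int k)) = \<dots>" .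
  \<comment> \<open>Otherwise \<open>[2 n] = (1 + q^n) [n]\<close> would be zero.\<close>
  have "1 + qvar ^ n \<noteq> 0"
    using qint_double [of n] \<open>n > 0\<close> by auto
  moreover have "n - a \<le> 2 * n - 1"
    using \<open>n > 0\<close> by simp
  ultimately have "?D \<noteq> 0"
    by simp
  moreover have "is_laurent_poly (\<Sum>i\<le>n. c i * b i)"
    using b c by (intro laurent_sum laurent_mult) auto
  ultimately show ?thesis
    unfolding laurent_cong_0_def sum_eq by simp
qed

end
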